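(* Let $x_0\in U$ be a Borwein properly efficient solution of NMFP (in particular $x_0\in X$), and let $s=(s_1,\dots,s_p)$ with $s_i=\frac{f_i(x_0)}{F_i(x_0)}$. Suppose that: (i) for all $i\in I$, $j\in J$, $k\in K$, the functions $f_i,F_i,g_j,h_k$ are locally Lipschitz continuous and regular in the sense of Clarke on $U$, and $f_i^{\circ\circ}(x;d)$, $g_j^{\circ\circ}(x;d)$, $h_k^{\circ\circ}(x;d)$ are finite for all $x\in U$ and all $d\in Z$; (ii) for all $i\in I$, $F_i$ is Gâteaux differentiable on $U$ with Gâteaux derivative $F'_{i,G}$, and $F_i''(x;d)$ exists for all $x\in U$ and all $d\in Z$. Let $v\in D(x_0)$ and suppose the generalized second-order Abadie-type regularity condition $\widetilde C^2(Q,x_0,v)\subseteq\widetilde T^2(X,x_0,v)$ holds. Then for any $r\ge0$ the system $$\left\{\begin{array}{l} f_i^{\circ}(x_0;w)+rf_i^{\circ\circ}(x_0;v)-s_i\big(\langle F'_{i,G}(x_0),w\rangle+rF_i''(x_0;v)\big)\le0\quad\text{for all } i\in I,\\ f_i^{\circ}(x_0;w)+rf_i^{\circ\circ}(x_0;v)-s_i\big(\langle F'_{i,G}(x_0),w\rangle+rF_i''(x_0;v)\big)<0\quad\text{for some } i\in I,\\ g_j^{\circ}(x_0;w)+rg_j^{\circ\circ}(x_0;v)\le0\quad\text{for all } j\in J(x_0,v),\\ h_k^{\circ}(x_0;w)+rh_k^{\circ\circ}(x_0;v)=0\quad\text{for all } k\in K\end{array}\right.$$ has no solution $w\in Z$.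
   Context: Setting. $Z$ is a real reflexive Banach space with dual $Z^*$ and pairing $\langle\cdot,\cdot\rangle$; $U\subseteq Z$ is nonempty and open; $f,F:Z\to\mathbb{R}^p$, $g:Z\to\mathbb{R}^m$, $h:Z\to\mathbb{R}^l$ have components $f_i,F_i$ ($i\in I=\{1,\dots,p\}$), $g_j$ ($j\in J=\{1,\dots,m\}$), $h_k$ ($k\in K=\{1,\dots,l\}$), and $F_i(x)>0$ for all $x\in U$, $i\in I$. $\frac fF=(\frac{f_1}{F_1},\dots,\frac{f_p}{F_p})^\top$ on $U$. NMFP is the problem of minimizing $\frac{f}{F}$ over $X=\{x\in U: g_j(x)\le0\ \forall j\in J,\ h_k(x)=0\ \forall k\in K\}$. $\mathbb{R}_+=[0,\infty)$, $\mathbb{R}^p_+$ is the nonnegative orthant. Derivatives. For $\vartheta:U\to\mathbb{R}$, $x\in U$, $v\in Z$: $\vartheta'(x;v)=\lim_{t\to0^+}\frac{\vartheta(x+tv)-\vartheta(x)}{t}$; $\vartheta$ is Gâteaux differentiable at $x$ with Gâteaux derivative $\vartheta'_G(x)\in Z^*$ if $\vartheta'(x;v)$ exists and equals $\langle\vartheta'_G(x),v\rangle$ for all $v\in Z$; $\vartheta^{\circ}(x;v)=\limsup_{y\to x,\,t\to0^+}\frac{\vartheta(y+tv)-\vartheta(y)}{t}$ (Clarke); $\vartheta$ is regular in the sense of Clarke at $x$ if $\vartheta'(x;v)$ exists and equals $\vartheta^\circ(x;v)$ for all $v\in Z$; $\vartheta''(x;v)=\lim_{t\to0^+}\frac{\vartheta(x+tv)-\vartheta(x)-t\vartheta'(x;v)}{\frac12t^2}$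 if the limit exists; $\vartheta^{\circ\circ}(x;v)=\limsup_{t\to0^+}\frac{\vartheta(x+tv)-\vartheta(x)-t\vartheta^\circ(x;v)}{\frac12t^2}$ (Páles–Zeidan). Cones. For a subset $A$ of a normed space $Y$ and $a\in A$, the contingent cone is $T(A,a)=\{d\in Y:\exists\,t_k\to0^+,\ d_k\to d,\ a+t_kd_k\in A\ \forall k\}$. For $x_0\in X$, $v\in Z$: $J(x_0)=\{j\in J:g_j(x_0)=0\}$, $J(x_0,v)=\{j\in J(x_0):g_j^\circ(x_0;v)=0\}$; the linearizing cone is $$C(Q,x_0)=\{d\in Z:\ (\tfrac{f_i}{F_i})^\circ(x_0;d)\le0\ \forall i\in I,\ g_j^\circ(x_0;d)\le0\ \forall j\in J(x_0),\ h_k^\circ(x_0;d)=0\ \forall k\in K\}$$ (here $Q$ is only part of the notation); the set of critical points is $D(x_0)=T(X,x_0)\cap C(Q,x_0)$. The projective second-order tangent cone of $X$ at $x_0$ in direction $v$ is $$\widetilde T^2(X,x_0,v)=\{(w,r)\in Z\times\mathbb{R}_+:\exists\,t_k\to0^+,\ r_k\to r,\ w_k\to w\ \text{with } r_k>0,\ \tfrac{t_k}{r_k}\to0^+,\ x_0+t_kv+\tfrac12r_k^{-1}t_k^2w_k\in X\ \forall k\}.$$ The projective second-order linearizing cone is $$\widetilde C^2(Q,x_0,v)=\Big\{(w,r)\in Z\times\mathbb{R}_+:\ \begin{array}{l}(\tfrac{f_i}{F_i})^\circ(x_0;w)+r(\tfrac{f_i}{F_i})^{\circ\circ}(x_0;v)\le0\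 \forall i\in I,\\ g_j^\circ(x_0;w)+rg_j^{\circ\circ}(x_0;v)\le0\ \forall j\in J(x_0,v),\\ h_k^\circ(x_0;w)+rh_k^{\circ\circ}(x_0;v)=0\ \forall k\in K\end{array}\Big\}.$$ Borwein properly efficient solution. $x_0\in X$ is a Borwein properly efficient solution of NMFP if $T\big((\frac fF)(X)+\mathbb{R}^p_+,\ (\frac fF)(x_0)\big)\cap(-\mathbb{R}^p_+)=\{0\}$. *)

theory Defs
  imports "HOL-Analysis.Analysis"
begin

text \<open>The class \<open>banach\<close> provides completeness; reflexivity is surjectivity of the
  canonical embedding into the bidual.\<close>

definition reflexive_space :: "'z::real_normed_vector itself \<Rightarrow> bool" where
  "reflexive_space _ \<longleftrightarrow>
     (\<forall>\<Phi> :: ('z \<Rightarrow>\<^sub>L real) \<Rightarrow>\<^sub>L real. \<exists>z::'z. \<forall>\<xi>.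
        blinfun_apply \<Phi> \<xi> = blinfun_apply \<xi> z)"

definition locally_lipschitz_on :: "'z::metric_space set \<Rightarrow> ('z \<Rightarrow> real) \<Rightarrow> bool" where
  "locally_lipschitz_on U \<theta> \<longleftrightarrow>
     (\<forall>x\<in>U. \<exists>e>0. \<exists>L. L-lipschitz_on (cball x e \<inter> U) \<theta>)"

subsection \<open>Generalized derivatives\<close>

text \<open>Functions are total on the space. At a point of an open set \<open>U\<close> all the limits below
  depend only on the values of \<open>\<theta>\<close> on \<open>U\<close>. Limits (\<open>dir_deriv\<close>, \<open>dir_deriv2\<close>) are real numbers and
  are meaningful only together with the corresponding existence predicate; upper limits are
  extended reals.\<close>

definition dir_deriv_exists ::
    "('z::real_normed_vector \<Rightarrow> real) \<Rightarrow> 'z \<Rightarrow> 'z \<Rightarrow> bool" where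
  "dir_deriv_exists \<theta> x v \<longleftrightarrow>
     (\<exists>L. ((\<lambda>t. (\<theta> (x + t *\<^sub>R v) - \<theta> x) / t) \<longlongrightarrow> L) (at_right 0))"

definition dir_deriv :: "('z::real_normed_vector \<Rightarrow> real) \<Rightarrow> 'z \<Rightarrow> 'z \<Rightarrow> real" where
  "dir_deriv \<theta> x v = Lim (at_right 0) (\<lambda>t. (\<theta> (x + t *\<^sub>R v) - \<theta> x) / t)"

definition has_gateaux_derivative ::
    "('z::real_normed_vector \<Rightarrow> real) \<Rightarrow> ('z \<Rightarrow>\<^sub>L real) \<Rightarrow> 'z \<Rightarrow> bool" where
  "has_gateaux_derivative \<theta> D x \<longleftrightarrow>
     (\<forall>v. dir_deriv_exists \<theta> x v \<and> dir_deriv \<theta> x v = blinfun_apply D v)"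

text \<open>The base point \<open>y\<close> is allowed to be \<open>x\<close>, hence \<open>nhds\<close> rather than \<open>at\<close>.\<close>

definition clarke_deriv :: "('z::real_normed_vector \<Rightarrow> real) \<Rightarrow> 'z \<Rightarrow> 'z \<Rightarrow> ereal" where
  "clarke_deriv \<theta> x v =
     Limsup (nhds x \<times>\<^sub>F at_right 0) (\<lambda>(y, t). ereal ((\<theta> (y + t *\<^sub>R v) - \<theta> y) / t))"

definition clarke_regular :: "('z::real_normed_vector \<Rightarrow> real) \<Rightarrow> 'z \<Rightarrow> bool" where
  "clarke_regular \<theta> x \<longleftrightarrow>
     (\<forall>v. dir_deriv_exists \<theta> x v \<and> ereal (dir_deriv \<theta> x v) = clarke_deriv \<theta> x v)"

definition dir_deriv2_exists ::
    "('z::real_normed_vector \<Rightarrow> real) \<Rightarrow> 'z \<Rightarrow> 'z \<Rightarrow> bool" where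
  "dir_deriv2_exists \<theta> x v \<longleftrightarrow> dir_deriv_exists \<theta> x v \<and>
     (\<exists>L. ((\<lambda>t. (\<theta> (x + t *\<^sub>R v) - \<theta> x - t * dir_deriv \<theta> x v) / (1/2 * t\<^sup>2)) \<longlongrightarrow> L)
            (at_right 0))"

definition dir_deriv2 :: "('z::real_normed_vector \<Rightarrow> real) \<Rightarrow> 'z \<Rightarrow> 'z \<Rightarrow> real" where
  "dir_deriv2 \<theta> x v =
     Lim (at_right 0) (\<lambda>t. (\<theta> (x + t *\<^sub>R v) - \<theta> x - t * dir_deriv \<theta> x v) / (1/2 * t\<^sup>2))"

text \<open>The second-order upper derivative of Pales and Zeidan. For \<open>\<theta>\<close> Lipschitz near \<open>x\<close>
  the first-order Clarke derivative is finite, so no undefined extended-real difference occurs.\<close>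

definition pz_deriv2 :: "('z::real_normed_vector \<Rightarrow> real) \<Rightarrow> 'z \<Rightarrow> 'z \<Rightarrow> ereal" where
  "pz_deriv2 \<theta> x v =
     Limsup (at_right 0) (\<lambda>t. (ereal (\<theta> (x + t *\<^sub>R v) - \<theta> x) - ereal t * clarke_deriv \<theta> x v)
                                / ereal (1/2 * t\<^sup>2))"

subsection \<open>The problem\<close>

text \<open>The constraint maps are given by their components \<open>g j\<close> for \<open>j \<in> {1..m}\<close> and \<open>h k\<close> for
  \<open>k \<in> {1..l}\<close>, so that \<open>m = 0\<close> and \<open>l = 0\<close> are possible; values at other indices are
  irrelevant.\<close>

definition feasible_set ::
    "'z set \<Rightarrow> nat \<Rightarrow> (nat \<Rightarrow> 'z \<Rightarrow> real) \<Rightarrow> nat \<Rightarrow> (nat \<Rightarrow> 'z \<Rightarrow> real) \<Rightarrow> 'z set" where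
  "feasible_set U m g l h =
     {x\<in>U. (\<forall>j\<in>{1..m}. g j x \<le> 0) \<and> (\<forall>k\<in>{1..l}. h k x = 0)}"

definition ratio :: "('z \<Rightarrow> real^'p) \<Rightarrow> ('z \<Rightarrow> real^'p) \<Rightarrow> 'z \<Rightarrow> real^'p" where
  "ratio f F x = (\<chi> i. f x $ i / F x $ i)"

definition nonneg_orthant :: "(real^'p) set" where
  "nonneg_orthant = {y. \<forall>i. 0 \<le> y $ i}"

definition contingent_cone :: "'y::real_normed_vector set \<Rightarrow> 'y \<Rightarrow> 'y set" where
  "contingent_cone A a =
     {d. \<exists>t :: nat \<Rightarrow> real. \<exists>e :: nat \<Rightarrow> 'y.
           (\<forall>n. 0 < t n) \<and> t \<longlonglongrightarrow> 0 \<and> e \<longlonglongrightarrow> d \<and> (\<forall>n. a + t n *\<^sub>R e n \<in> A)}"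

definition borwein_properly_efficient :: "'z set \<Rightarrow> ('z \<Rightarrow> real^'p) \<Rightarrow> 'z \<Rightarrow> bool" where
  "borwein_properly_efficient X \<phi> x0 \<longleftrightarrow> x0 \<in> X \<and>
     contingent_cone {\<phi> x + y |x y. x \<in> X \<and> y \<in> nonneg_orthant} (\<phi> x0)
       \<inter> uminus ` nonneg_orthant = {0}"

subsection \<open>First- and second-order cones\<close>

definition active_set :: "nat \<Rightarrow> (nat \<Rightarrow> 'z \<Rightarrow> real) \<Rightarrow> 'z \<Rightarrow> nat set" where
  "active_set m g x0 = {j\<in>{1..m}. g j x0 = 0}"

definition active_set_dir ::
    "nat \<Rightarrow> (nat \<Rightarrow> 'z::real_normed_vector \<Rightarrow> real) \<Rightarrow> 'z \<Rightarrow> 'z \<Rightarrow> nat set" where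
  "active_set_dir m g x0 v = {j \<in> active_set m g x0. clarke_deriv (g j) x0 v = 0}"

definition linearizing_cone ::
    "('z::real_normed_vector \<Rightarrow> real^'p) \<Rightarrow> ('z \<Rightarrow> real^'p) \<Rightarrow> nat \<Rightarrow> (nat \<Rightarrow> 'z \<Rightarrow> real)
      \<Rightarrow> nat \<Rightarrow> (nat \<Rightarrow> 'z \<Rightarrow> real) \<Rightarrow> 'z \<Rightarrow> 'z set" where
  "linearizing_cone f F m g l h x0 =
     {d. (\<forall>i. clarke_deriv (\<lambda>x. ratio f F x $ i) x0 d \<le> 0) \<and>
         (\<forall>j\<in>active_set m g x0. clarke_deriv (g j) x0 d \<le> 0) \<and>
         (\<forall>k\<in>{1..l}. clarke_deriv (h k) x0 d = 0)}"

definition critical_points ::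
    "'z::real_normed_vector set \<Rightarrow> ('z \<Rightarrow> real^'p) \<Rightarrow> ('z \<Rightarrow> real^'p) \<Rightarrow> nat \<Rightarrow>
      (nat \<Rightarrow> 'z \<Rightarrow> real) \<Rightarrow> nat \<Rightarrow> (nat \<Rightarrow> 'z \<Rightarrow> real) \<Rightarrow> 'z \<Rightarrow> 'z set" where
  "critical_points U f F m g l h x0 =
     contingent_cone (feasible_set U m g l h) x0 \<inter> linearizing_cone f F m g l h x0"

definition proj_tangent_cone2 ::
    "'z::real_normed_vector set \<Rightarrow> 'z \<Rightarrow> 'z \<Rightarrow> ('z \<times> real) set" where
  "proj_tangent_cone2 X x0 v =
     {(w, r). 0 \<le> r \<and>
        (\<exists>(t :: nat \<Rightarrow> real) (\<rho> :: nat \<Rightarrow> real) (\<omega> :: nat \<Rightarrow> 'z).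
           (\<forall>n. 0 < t n) \<and> t \<longlonglongrightarrow> 0 \<and> (\<forall>n. 0 < \<rho> n) \<and> \<rho> \<longlonglongrightarrow> r \<and> \<omega> \<longlonglongrightarrow> w \<and>
           (\<lambda>n. t n / \<rho> n) \<longlonglongrightarrow> 0 \<and>
           (\<forall>n. x0 + t n *\<^sub>R v + (1/2 * inverse (\<rho> n) * (t n)\<^sup>2) *\<^sub>R \<omega> n \<in> X))}"

definition proj_linearizing_cone2 ::
    "('z::real_normed_vector \<Rightarrow> real^'p) \<Rightarrow> ('z \<Rightarrow> real^'p) \<Rightarrow> nat \<Rightarrow> (nat \<Rightarrow> 'z \<Rightarrow> real)
      \<Rightarrow> nat \<Rightarrow> (nat \<Rightarrow> 'z \<Rightarrow> real) \<Rightarrow> 'z \<Rightarrow> 'z \<Rightarrow> ('z \<times> real) set" where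
  "proj_linearizing_cone2 f F m g l h x0 v =
     {(w, r). 0 \<le> r \<and>
        (\<forall>i. clarke_deriv (\<lambda>x. ratio f F x $ i) x0 w
               + ereal r * pz_deriv2 (\<lambda>x. ratio f F x $ i) x0 v \<le> 0) \<and>
        (\<forall>j\<in>active_set_dir m g x0 v.
           clarke_deriv (g j) x0 w + ereal r * pz_deriv2 (g j) x0 v \<le> 0) \<and>
        (\<forall>k\<in>{1..l}. clarke_deriv (h k) x0 w + ereal r * pz_deriv2 (h k) x0 v = 0)}"

end

theory Submission
  imports Defs
begin

text \<open>Write \<open>\<phi> = f / F\<close>. Regularity together with linearity of the derivative makes each \<open>F i\<close>
  strictly differentiable, which gives the upper quotient rule
  \<open>\<phi>\<^sub>i\<degree>(x0; w) \<le> (f\<^sub>i\<degree>(x0; w) - s\<^sub>i \<langle>F'\<^sub>i, w\<rangle>) / F\<^sub>i(x0)\<close>. Proper efficiency upgrades criticality of \<open>v\<close>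
  to \<open>\<phi>\<^sub>i\<degree>(x0; v) = 0\<close>; this removes the mixed term \<open>-2 \<phi>\<^sub>i\<degree>(x0; v) \<langle>F'\<^sub>i, v\<rangle> / F\<^sub>i(x0)\<close> from the
  second-order quotient rule. A solution \<open>w\<close> of the system thus yields a pair \<open>(w, r)\<close> in the
  projective linearizing cone, hence a feasible second-order curve, along which the upper limits of
  the difference quotients of \<open>\<phi>\<^sub>i\<close> are nonpositive and one of them is negative. Raising the
  quotients by elements of the orthant turns these upper limits into limits, that is, into
  a nonzero element of the contingent cone in the negative orthant.\<close>

section \<open>Real upper bounds for upper limits along a filter\<close>

text \<open>Says that the upper limit of \<open>q\<close> along \<open>G\<close> is at most
  \<open>a\<close>, through a convergent majorant. This keeps all estimates in the reals: sums,
  nonnegative factors and substitutions reduce to the rules for ordinary limits, without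
  extended-real arithmetic.\<close>

definition limsup_le :: "'a filter \<Rightarrow> ('a \<Rightarrow> real) \<Rightarrow> real \<Rightarrow> bool" where
  "limsup_le G q a \<longleftrightarrow> (\<exists>b. (\<forall>\<^sub>F x in G. q x \<le> b x) \<and> (b \<longlongrightarrow> a) G)"

lemma limsup_leI: "\<forall>\<^sub>F x in G. q x \<le> b x \<Longrightarrow> (b \<longlongrightarrow> a) G \<Longrightarrow> limsup_le G q a"
  unfolding limsup_le_def by blast

lemma limsup_le_tendsto: "(q \<longlongrightarrow> a) G \<Longrightarrow> limsup_le G q a"
  unfolding limsup_le_def by (intro exI[of _ q]) auto

lemma limsup_le_mono:
  assumes "limsup_le G q a" "\<forall>\<^sub>F x in G. p x \<le> q x"
  shows "limsup_le G p a"
proof -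
  from assms(1) obtain b where b: "\<forall>\<^sub>F x in G. q x \<le> b x" "(b \<longlongrightarrow> a) G"
    unfolding limsup_le_def by blast
  have "\<forall>\<^sub>F x in G. p x \<le> b x"
    using b(1) assms(2) by eventually_elim auto
  then show ?thesis using b(2) by (rule limsup_leI)
qed

lemma limsup_le_add:
  assumes "limsup_le G p a" "limsup_le G q b"
  shows "limsup_le G (\<lambda>x. p x + q x) (a + b)"
proof -
  from assms obtain c d where c: "\<forall>\<^sub>F x in G. p x \<le> c x" "(c \<longlongrightarrow> a) G"
    and d: "\<forall>\<^sub>F x in G. q x \<le> d x" "(d \<longlongrightarrow> b) G"
    unfolding limsup_le_def by blast
  have "\<forall>\<^sub>F x in G. p x + q x \<le> c x + d x"
    using c(1) d(1) by eventually_elim auto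
  moreover have "((\<lambda>x. c x + d x) \<longlongrightarrow> a + b) G"
    by (intro tendsto_intros c d)
  ultimately show ?thesis by (rule limsup_leI)
qed

lemma limsup_le_mult:
  assumes "limsup_le G q a" "\<forall>\<^sub>F x in G. 0 \<le> c x" "(c \<longlongrightarrow> c0) G"
  shows "limsup_le G (\<lambda>x. c x * q x) (c0 * a)"
proof -
  from assms(1) obtain b where b: "\<forall>\<^sub>F x in G. q x \<le> b x" "(b \<longlongrightarrow> a) G"
    unfolding limsup_le_def by blast
  have "\<forall>\<^sub>F x in G. c x * q x \<le> c x * b x"
    using b(1) assms(2) by eventually_elim (auto intro: mult_left_mono)
  moreover have "((\<lambda>x. c x * b x) \<longlongrightarrow> c0 * a) G"
    by (intro tendsto_intros b assms)
  ultimately show ?thesis by (rule limsup_leI)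
qed

lemma limsup_le_compose:
  assumes "limsup_le G q a" "filterlim p G H"
  shows "limsup_le H (\<lambda>x. q (p x)) a"
proof -
  from assms(1) obtain b where b: "\<forall>\<^sub>F x in G. q x \<le> b x" "(b \<longlongrightarrow> a) G"
    unfolding limsup_le_def by blast
  have "\<forall>\<^sub>F x in H. q (p x) \<le> b (p x)"
    using b(1) assms(2) unfolding filterlim_iff by blast
  moreover have "((\<lambda>x. b (p x)) \<longlongrightarrow> a) H"
    using b(2) assms(2) by (rule filterlim_compose)
  ultimately show ?thesis by (rule limsup_leI)
qed

text \<open>\<open>max (q x) a\<close> is squeezed between \<open>a\<close> and
  \<open>max (b x) a\<close>. This turns a one-sided bound into a genuine limit, at the price of
  raising \<open>q\<close>.\<close>

lemma limsup_le_max: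
  assumes "limsup_le G q a"
  shows "((\<lambda>x. max (q x) a) \<longlongrightarrow> a) G"
proof -
  from assms obtain b where b: "\<forall>\<^sub>F x in G. q x \<le> b x" "(b \<longlongrightarrow> a) G"
    unfolding limsup_le_def by blast
  have "((\<lambda>x. max (b x) a) \<longlongrightarrow> max a a) G"
    by (intro tendsto_intros b)
  then have lim: "((\<lambda>x. max (b x) a) \<longlongrightarrow> a) G" by simp
  have "\<forall>\<^sub>F x in G. max (q x) a \<le> max (b x) a"
    using b(1) by eventually_elim auto
  then show ?thesis
    by (rule tendsto_sandwich[OF _ _ tendsto_const lim, rotated]) simp_all
qed

text \<open>Link to the extended-real definitions. For the converse, \<open>max (q x) a\<close>
  itself serves as the convergent majorant.\<close>

lemma limsup_le_iff_Limsup: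
  assumes "G \<noteq> bot"
  shows "limsup_le G q a \<longleftrightarrow> Limsup G (\<lambda>x. ereal (q x)) \<le> ereal a"
proof
  assume "limsup_le G q a"
  then have "((\<lambda>x. ereal (max (q x) a)) \<longlongrightarrow> ereal a) G"
    by (intro tendsto_intros limsup_le_max)
  then have "Limsup G (\<lambda>x. ereal (max (q x) a)) = ereal a"
    using assms lim_imp_Limsup by blast
  moreover have "Limsup G (\<lambda>x. ereal (q x)) \<le> Limsup G (\<lambda>x. ereal (max (q x) a))"
    by (intro Limsup_mono) auto
  ultimately show "Limsup G (\<lambda>x. ereal (q x)) \<le> ereal a" by simp
next
  assume L: "Limsup G (\<lambda>x. ereal (q x)) \<le> ereal a"
  have "\<forall>\<^sub>F x in G. dist (max (q x) a) a < e" if "e > 0" for e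
  proof -
    have "Limsup G (\<lambda>x. ereal (q x)) < ereal (a + e)"
      using L that by (meson ereal_less_eq(3) less_add_same_cancel1 less_ereal.simps(1) order_le_less_trans)
    then have "\<forall>\<^sub>F x in G. ereal (q x) < ereal (a + e)"
      by (rule Limsup_lessD)
    then show ?thesis
      by eventually_elim (use that in \<open>auto simp: dist_real_def max_def\<close>)
  qed
  then have "((\<lambda>x. max (q x) a) \<longlongrightarrow> a) G" by (intro tendstoI)
  then show "limsup_le G q a" by (intro limsup_leI[of q "\<lambda>x. max (q x) a"]) simp_all
qed

section \<open>Clarke derivatives with moving base points and directions\<close>

lemma clarke_deriv_le_iff:
  "clarke_deriv \<theta> x v \<le> ereal a \<longleftrightarrow>
    limsup_le (nhds x \<times>\<^sub>F at_right 0) (\<lambda>(y, t). (\<theta> (y + t *\<^sub>R v) - \<theta> y) / t) a"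
proof -
  have "nhds x \<times>\<^sub>F at_right (0::real) \<noteq> bot"
    by (simp add: prod_filter_eq_bot)
  then show ?thesis
    unfolding clarke_deriv_def case_prod_unfold by (subst limsup_le_iff_Limsup) simp_all
qed

text \<open>The joint upper limit admits the constant base point \<open>x\<close>, because
  \<open>nhds x\<close> contains \<open>x\<close> itself; restricting to it can only lower the
  value.\<close>

lemma clarke_deriv_ge_tendsto:
  assumes "((\<lambda>t. (\<theta> (x + t *\<^sub>R v) - \<theta> x) / t) \<longlongrightarrow> a) (at_right 0)"
  shows "ereal a \<le> clarke_deriv \<theta> x v"
\<comment> \<open>Comparing with real upper bounds \<open>c\<close> only avoids a case split on an
  infinite Clarke derivative.\<close>
proof (rule ereal_le_real)
  fix c :: real
  assume "clarke_deriv \<theta> x v \<le> ereal c"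
  then have "limsup_le (nhds x \<times>\<^sub>F at_right 0) (\<lambda>(y, t). (\<theta> (y + t *\<^sub>R v) - \<theta> y) / t) c"
    by (simp add: clarke_deriv_le_iff)
  moreover have "filterlim (\<lambda>t. (x, t)) (nhds x \<times>\<^sub>F at_right (0::real)) (at_right 0)"
    by (intro filterlim_Pair filterlim_ident tendsto_const)
  ultimately have "limsup_le (at_right 0) (\<lambda>t. (\<theta> (x + t *\<^sub>R v) - \<theta> x) / t) c"
    using limsup_le_compose by fastforce
  then have "((\<lambda>t. max ((\<theta> (x + t *\<^sub>R v) - \<theta> x) / t) c) \<longlongrightarrow> c) (at_right 0)"
    by (rule limsup_le_max)
  then show "ereal a \<le> ereal c"
    using tendsto_le[OF _ _ assms] by fastforce
qed

lemma locally_lipschitz_on_imp_isCont: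
  assumes "locally_lipschitz_on U \<theta>" "open U" "x \<in> U"
  shows "isCont \<theta> x"
proof -
  obtain e L where e: "e > 0" "L-lipschitz_on (cball x e \<inter> U) \<theta>"
    using assms unfolding locally_lipschitz_on_def by blast
  have "continuous_on (ball x e \<inter> U) \<theta>"
    by (rule lipschitz_on_continuous_on[OF lipschitz_on_subset[OF e(2)]]) auto
  moreover have "open (ball x e \<inter> U)" "x \<in> ball x e \<inter> U"
    using assms e(1) by auto
  ultimately show ?thesis
    using continuous_on_eq_continuous_at by blast
qed

text \<open>The Lipschitz bound makes the quotient at most \<open>L * norm (w n - w0)\<close> once
  both points lie in the Lipschitz neighbourhood. Hence directions may vary with \<open>n\<close> in
  everything that follows.\<close>

lemma locally_lipschitz_on_change_direction:
  fixes \<theta> :: "'z::real_normed_vector \<Rightarrow> real"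
  assumes lip: "locally_lipschitz_on U \<theta>" "open U" "x \<in> U"
    and y: "(y \<longlongrightarrow> x) G" and t: "filterlim t (at_right 0) G" and w: "(w \<longlongrightarrow> w0) G"
  shows "((\<lambda>n. (\<theta> (y n + t n *\<^sub>R w n) - \<theta> (y n + t n *\<^sub>R w0)) / t n) \<longlongrightarrow> 0) G"
proof -
  obtain e L where e: "e > 0" "L-lipschitz_on (cball x e \<inter> U) \<theta>"
    using lip unfolding locally_lipschitz_on_def by blast
  have t0: "(t \<longlongrightarrow> 0) G" and tpos: "\<forall>\<^sub>F n in G. 0 < t n"
    using t unfolding filterlim_at by (auto elim: eventually_mono)
  have "((\<lambda>n. y n + t n *\<^sub>R w n) \<longlongrightarrow> x + 0 *\<^sub>R w0) G"
    by (intro tendsto_intros y t0 w)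
  moreover have "((\<lambda>n. y n + t n *\<^sub>R w0) \<longlongrightarrow> x + 0 *\<^sub>R w0) G"
    by (intro tendsto_intros y t0)
  moreover have "open (ball x e \<inter> U)" "x \<in> ball x e \<inter> U"
    using lip e(1) by auto
  ultimately have "\<forall>\<^sub>F n in G. y n + t n *\<^sub>R w n \<in> ball x e \<inter> U"
    "\<forall>\<^sub>F n in G. y n + t n *\<^sub>R w0 \<in> ball x e \<inter> U"
    by (auto simp del: Int_iff elim!: topological_tendstoD)
  then have "\<forall>\<^sub>F n in G. norm ((\<theta> (y n + t n *\<^sub>R w n) - \<theta> (y n + t n *\<^sub>R w0)) / t n)
      \<le> L * norm (w n - w0)"
    using tpos
  proof eventually_elim
    case (elim n)
    have "dist (\<theta> (y n + t n *\<^sub>R w n)) (\<theta> (y n + t n *\<^sub>R w0))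
        \<le> L * dist (y n + t n *\<^sub>R w n) (y n + t n *\<^sub>R w0)"
      by (rule lipschitz_onD[OF e(2)]) (use elim in auto)
    also have "dist (y n + t n *\<^sub>R w n) (y n + t n *\<^sub>R w0) = t n * norm (w n - w0)"
      using elim(3) by (simp add: dist_norm flip: scaleR_diff_right)
    finally show ?case
      using elim(3) by (simp add: dist_norm divide_le_eq mult_ac)
  qed
  moreover have "((\<lambda>n. L * norm (w n - w0)) \<longlongrightarrow> L * norm (w0 - w0)) G"
    by (intro tendsto_intros w)
  then have "((\<lambda>n. L * norm (w n - w0)) \<longlongrightarrow> 0) G" by simp
  ultimately show ?thesis
    by (rule Lim_null_comparison)
qed

lemma clarke_deriv_limsup_le:
  assumes lip: "locally_lipschitz_on U \<theta>" "open U" "x \<in> U"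
    and a: "clarke_deriv \<theta> x w0 \<le> ereal a"
    and lims: "(y \<longlongrightarrow> x) G" "filterlim t (at_right 0) G" "(w \<longlongrightarrow> w0) G"
  shows "limsup_le G (\<lambda>n. (\<theta> (y n + t n *\<^sub>R w n) - \<theta> (y n)) / t n) a"
proof -
  have "filterlim (\<lambda>n. (y n, t n)) (nhds x \<times>\<^sub>F at_right 0) G"
    by (intro filterlim_Pair lims)
  from limsup_le_compose[OF a[unfolded clarke_deriv_le_iff] this]
  have "limsup_le G (\<lambda>n. (\<theta> (y n + t n *\<^sub>R w0) - \<theta> (y n)) / t n) a"
    by simp
  from limsup_le_add[OF this
      limsup_le_tendsto[OF locally_lipschitz_on_change_direction[OF lip lims]]]
  show ?thesis by (simp add: diff_divide_distrib)
qed

text \<open>Strict differentiability: the Clarke derivative equals the linear map \<open>D\<close>,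
  so its bound in the direction \<open>- w0\<close> is \<open>- D w0\<close>, and the two upper
  bounds become a two-sided estimate.\<close>

lemma gateaux_clarke_regular_strict:
  assumes lip: "locally_lipschitz_on U \<theta>" "open U" "x \<in> U"
    and reg: "clarke_regular \<theta> x" "has_gateaux_derivative \<theta> D x"
    and lims: "(y \<longlongrightarrow> x) G" "filterlim t (at_right 0) G" "(w \<longlongrightarrow> w0) G"
  shows "((\<lambda>n. (\<theta> (y n + t n *\<^sub>R w n) - \<theta> (y n)) / t n) \<longlongrightarrow> blinfun_apply D w0) G"
proof -
  have cl: "clarke_deriv \<theta> x u = ereal (blinfun_apply D u)" for u
    using reg unfolding clarke_regular_def has_gateaux_derivative_def by metis
  let ?q = "\<lambda>n. (\<theta> (y n + t n *\<^sub>R w n) - \<theta> (y n)) / t n"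
  have up: "limsup_le G ?q (blinfun_apply D w0)"
    using clarke_deriv_limsup_le[OF lip _ lims] cl by simp
  have t0: "(t \<longlongrightarrow> 0) G"
    using lims(2) unfolding filterlim_at by auto
  have "((\<lambda>n. y n + t n *\<^sub>R w n) \<longlongrightarrow> x + 0 *\<^sub>R w0) G"
    by (intro tendsto_intros lims t0)
  \<comment> \<open>Stepping back by \<open>- w n\<close> from the shifted base point
    \<open>y n + t n *\<^sub>R w n\<close> ends at \<open>y n\<close>, so the resulting quotient is
    exactly \<open>- ?q n\<close>.\<close>
  then have z: "((\<lambda>n. y n + t n *\<^sub>R w n) \<longlongrightarrow> x) G" by simp
  have "((\<lambda>n. - w n) \<longlongrightarrow> - w0) G" by (intro tendsto_intros lims)
  from clarke_deriv_limsup_le[OF lip _ z lims(2) this, of "- blinfun_apply D w0"]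
  have "limsup_le G (\<lambda>n. - ?q n) (- blinfun_apply D w0)"
    by (simp add: cl blinfun.minus_right minus_divide_left del: divide_minus_left)
  from tendsto_minus[OF limsup_le_max[OF this]]
  have lo: "((\<lambda>n. - max (- ?q n) (- blinfun_apply D w0)) \<longlongrightarrow> blinfun_apply D w0) G"
    by simp
  show ?thesis
    by (rule tendsto_sandwich[OF _ _ lo limsup_le_max[OF up]]) (auto simp: max_def)
qed

section \<open>First- and second-order quotient rules\<close>

lemma quotient_difference:
  fixes a b :: real
  assumes "b \<noteq> 0" "b' \<noteq> 0"
  shows "(a' / b' - a / b) / t = inverse b' * ((a' - a) / t) - a / b * inverse b' * ((b' - b) / t)"
  using assms by (cases "t = 0") (auto simp: field_simps)

text \<open>If the slope of the numerator is \<open>a / b\<close> times the slope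
  \<open>\<beta>\<close> of the denominator, the quotient has slope zero: the two first-order terms
  cancel and no mixed term survives.\<close>

lemma quotient_difference_second_order:
  fixes a b :: real
  assumes "b \<noteq> 0" "b' \<noteq> 0"
  shows "(a' / b' - a / b) / T
    = inverse b' * ((a' - a - t * (a / b * \<beta>)) / T + - (a / b) * ((b' - b - t * \<beta>) / T))"
proof -
  have eq: "(a' - a - t * (a / b * \<beta>)) + - (a / b) * (b' - b - t * \<beta>) = b' * (a' / b' - a / b)"
    using assms by (simp add: field_simps)
  have "inverse b' * ((a' - a - t * (a / b * \<beta>)) / T + - (a / b) * ((b' - b - t * \<beta>) / T))
      = inverse b' * (((a' - a - t * (a / b * \<beta>)) + - (a / b) * (b' - b - t * \<beta>)) / T)"
    by (simp only: times_divide_eq_right add_divide_distrib)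
  then show ?thesis
    unfolding eq using assms by simp
qed

text \<open>The factor \<open>inverse (b (z n))\<close> is eventually positive, so an upper bound
  suffices for the numerator. The coefficient \<open>- a / b\<close> of the denominator's quotient
  has unknown sign, so a true limit is assumed there.\<close>

lemma limsup_le_quotient:
  fixes a b :: "'z::real_normed_vector \<Rightarrow> real"
  assumes cont: "isCont a x" "isCont b x" and pos: "0 < b x"
    and y: "(y \<longlongrightarrow> x) G" and z: "(z \<longlongrightarrow> x) G"
    and a: "limsup_le G (\<lambda>n. (a (z n) - a (y n)) / t n) \<alpha>"
    and b: "((\<lambda>n. (b (z n) - b (y n)) / t n) \<longlongrightarrow> \<beta>) G"
  shows "limsup_le G (\<lambda>n. (a (z n) / b (z n) - a (y n) / b (y n)) / t n)
    ((\<alpha> - a x / b x * \<beta>) / b x)"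
proof -
  note lim = isCont_tendsto_compose[OF cont(1) y] isCont_tendsto_compose[OF cont(2) y]
    isCont_tendsto_compose[OF cont(2) z]
  have pos_y: "\<forall>\<^sub>F n in G. 0 < b (y n)" and pos_z: "\<forall>\<^sub>F n in G. 0 < b (z n)"
    using order_tendstoD(1)[OF lim(2) pos] order_tendstoD(1)[OF lim(3) pos] .
  have "limsup_le G (\<lambda>n. inverse (b (z n)) * ((a (z n) - a (y n)) / t n)) (inverse (b x) * \<alpha>)"
    by (rule limsup_le_mult[OF a]) (use pos_z pos lim(3) in \<open>auto elim: eventually_mono intro: tendsto_inverse\<close>)
  moreover have "((\<lambda>n. - (a (y n) / b (y n) * inverse (b (z n)) * ((b (z n) - b (y n)) / t n)))
      \<longlongrightarrow> - (a x / b x * inverse (b x) * \<beta>)) G"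
    using pos by (intro tendsto_intros lim b) auto
  ultimately have "limsup_le G (\<lambda>n. inverse (b (z n)) * ((a (z n) - a (y n)) / t n)
      + - (a (y n) / b (y n) * inverse (b (z n)) * ((b (z n) - b (y n)) / t n)))
      (inverse (b x) * \<alpha> + - (a x / b x * inverse (b x) * \<beta>))"
    by (intro limsup_le_add[OF _ limsup_le_tendsto])
  moreover have "inverse (b x) * \<alpha> + - (a x / b x * inverse (b x) * \<beta>)
      = (\<alpha> - a x / b x * \<beta>) / b x"
    using pos by (simp add: field_simps)
  moreover have "\<forall>\<^sub>F n in G. (a (z n) / b (z n) - a (y n) / b (y n)) / t n
      \<le> inverse (b (z n)) * ((a (z n) - a (y n)) / t n)
        + - (a (y n) / b (y n) * inverse (b (z n)) * ((b (z n) - b (y n)) / t n))"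
    using pos_y pos_z by eventually_elim (simp add: quotient_difference)
  ultimately show ?thesis
    using limsup_le_mono by simp
qed

text \<open>An arbitrary filter is allowed so that one estimate serves both the joint filter of the
  Clarke derivative and sequences of feasible points.\<close>

lemma limsup_le_dir_quotient:
  fixes a b :: "'z::real_normed_vector \<Rightarrow> real"
  assumes U: "open U" "x \<in> U" and pos: "0 < b x"
    and lip: "locally_lipschitz_on U a" "locally_lipschitz_on U b"
    and a: "clarke_deriv a x w0 \<le> ereal \<alpha>"
    and b: "clarke_regular b x" "has_gateaux_derivative b D x"
    and lims: "(y \<longlongrightarrow> x) G" "filterlim t (at_right 0) G" "(w \<longlongrightarrow> w0) G"
  shows "limsup_le G
    (\<lambda>n. (a (y n + t n *\<^sub>R w n) / b (y n + t n *\<^sub>R w n) - a (y n) / b (y n)) / t n)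
    ((\<alpha> - a x / b x * blinfun_apply D w0) / b x)"
proof -
  have t0: "(t \<longlongrightarrow> 0) G"
    using lims(2) unfolding filterlim_at by auto
  have "((\<lambda>n. y n + t n *\<^sub>R w n) \<longlongrightarrow> x + 0 *\<^sub>R w0) G"
    by (intro tendsto_intros lims t0)
  then have z: "((\<lambda>n. y n + t n *\<^sub>R w n) \<longlongrightarrow> x) G" by simp
  show ?thesis
    by (intro limsup_le_quotient z lims pos clarke_deriv_limsup_le[OF lip(1) U a]
        locally_lipschitz_on_imp_isCont[OF lip(1) U] locally_lipschitz_on_imp_isCont[OF lip(2) U]
        gateaux_clarke_regular_strict[OF lip(2) U b])
qed

lemma clarke_deriv_quotient_le:
  fixes a b :: "'z::real_normed_vector \<Rightarrow> real"
  assumes U: "open U" "x \<in> U" and pos: "0 < b x"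
    and lip: "locally_lipschitz_on U a" "locally_lipschitz_on U b"
    and a: "clarke_deriv a x w \<le> ereal \<alpha>"
    and b: "clarke_regular b x" "has_gateaux_derivative b D x"
  shows "clarke_deriv (\<lambda>x. a x / b x) x w \<le> ereal ((\<alpha> - a x / b x * blinfun_apply D w) / b x)"
proof -
  have "limsup_le (nhds x \<times>\<^sub>F at_right 0)
    (\<lambda>n. (a (fst n + snd n *\<^sub>R w) / b (fst n + snd n *\<^sub>R w) - a (fst n) / b (fst n)) / snd n)
    ((\<alpha> - a x / b x * blinfun_apply D w) / b x)"
    \<comment> \<open>Here \<open>G\<close> is the product filter itself, with its projections as
      base point and step size.\<close>
    by (intro limsup_le_dir_quotient[OF assms] filterlim_fst filterlim_snd tendsto_const)
  then show ?thesis
    unfolding clarke_deriv_le_iff case_prod_unfold .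
qed

lemma dir_deriv_tendsto:
  assumes "dir_deriv_exists \<theta> x v"
  shows "((\<lambda>t. (\<theta> (x + t *\<^sub>R v) - \<theta> x) / t) \<longlongrightarrow> dir_deriv \<theta> x v) (at_right 0)"
proof -
  obtain L where L: "((\<lambda>t. (\<theta> (x + t *\<^sub>R v) - \<theta> x) / t) \<longlongrightarrow> L) (at_right 0)"
    using assms unfolding dir_deriv_exists_def by blast
  then have "dir_deriv \<theta> x v = L"
    unfolding dir_deriv_def by (intro tendsto_Lim) simp_all
  with L show ?thesis by simp
qed

lemma dir_deriv2_tendsto:
  assumes "dir_deriv2_exists \<theta> x v"
  shows "((\<lambda>t. (\<theta> (x + t *\<^sub>R v) - \<theta> x - t * dir_deriv \<theta> x v) / (1/2 * t\<^sup>2))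
    \<longlongrightarrow> dir_deriv2 \<theta> x v) (at_right 0)"
proof -
  obtain L where L: "((\<lambda>t. (\<theta> (x + t *\<^sub>R v) - \<theta> x - t * dir_deriv \<theta> x v) / (1/2 * t\<^sup>2))
      \<longlongrightarrow> L) (at_right 0)"
    using assms unfolding dir_deriv2_exists_def by blast
  then have "dir_deriv2 \<theta> x v = L"
    unfolding dir_deriv2_def by (intro tendsto_Lim) simp_all
  with L show ?thesis by simp
qed

lemma tendsto_along_direction:
  fixes x v :: "'z::real_normed_vector"
  shows "((\<lambda>t. x + t *\<^sub>R v) \<longlongrightarrow> x) (at_right 0)"
proof -
  have "((\<lambda>t. x + t *\<^sub>R v) \<longlongrightarrow> x + 0 *\<^sub>R v) (at_right 0)"
    by (intro tendsto_intros)
  then show ?thesis by simp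
qed

text \<open>The bound is the ordinary directional derivative of the quotient at \<open>x\<close>.
  When \<open>a\<close> is regular and \<open>b\<close> has a Gateaux derivative, it matches the
  upper quotient rule.\<close>

lemma clarke_deriv_quotient_ge:
  fixes a b :: "'z::real_normed_vector \<Rightarrow> real"
  assumes cont: "isCont b x" and pos: "0 < b x"
    and a: "dir_deriv_exists a x v" and b: "dir_deriv_exists b x v"
  shows "ereal ((dir_deriv a x v - a x / b x * dir_deriv b x v) / b x)
    \<le> clarke_deriv (\<lambda>x. a x / b x) x v"
proof (rule clarke_deriv_ge_tendsto)
  let ?z = "\<lambda>t. x + t *\<^sub>R v"
  have bz: "((\<lambda>t. b (?z t)) \<longlongrightarrow> b x) (at_right 0)"
    by (rule isCont_tendsto_compose[OF cont tendsto_along_direction])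
  have "((\<lambda>t. inverse (b (?z t)) * ((a (?z t) - a x) / t)
        - a x / b x * inverse (b (?z t)) * ((b (?z t) - b x) / t))
      \<longlongrightarrow> inverse (b x) * dir_deriv a x v - a x / b x * inverse (b x) * dir_deriv b x v)
      (at_right 0)"
    using pos by (intro tendsto_intros bz dir_deriv_tendsto a b) auto
  moreover have "inverse (b x) * dir_deriv a x v - a x / b x * inverse (b x) * dir_deriv b x v
      = (dir_deriv a x v - a x / b x * dir_deriv b x v) / b x"
    using pos by (simp add: field_simps)
  moreover have "\<forall>\<^sub>F t in at_right 0. inverse (b (?z t)) * ((a (?z t) - a x) / t)
        - a x / b x * inverse (b (?z t)) * ((b (?z t) - b x) / t)
      = (a (?z t) / b (?z t) - a x / b x) / t"
    using order_tendstoD(1)[OF bz pos]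
  proof eventually_elim
    case (elim t)
    with pos have "b x \<noteq> 0" "b (?z t) \<noteq> 0" by auto
    from quotient_difference[OF this, of "a (?z t)" "a x" t] show ?case by (rule sym)
  qed
  ultimately show "((\<lambda>t. (a (?z t) / b (?z t) - a x / b x) / t)
      \<longlongrightarrow> (dir_deriv a x v - a x / b x * dir_deriv b x v) / b x) (at_right 0)"
    by (simp only: Lim_transform_eventually)
qed

lemma pz_deriv2_le_iff:
  assumes "clarke_deriv \<theta> x v = ereal c"
  shows "pz_deriv2 \<theta> x v \<le> ereal p \<longleftrightarrow>
    limsup_le (at_right 0) (\<lambda>t. (\<theta> (x + t *\<^sub>R v) - \<theta> x - t * c) / (1/2 * t\<^sup>2)) p"
proof -
  have "pz_deriv2 \<theta> x v
      = Limsup (at_right 0) (\<lambda>t. ereal ((\<theta> (x + t *\<^sub>R v) - \<theta> x - t * c) / (1/2 * t\<^sup>2)))"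
    unfolding pz_deriv2_def assms
    \<comment> \<open>The extended-real and the real quotient need to agree only for nonzero
      \<open>t\<close>.\<close>
    by (intro Limsup_eq) (auto simp: eventually_at_filter)
  then show ?thesis by (simp add: limsup_le_iff_Limsup)
qed

text \<open>Assumption \<open>a1\<close> provides the slope relation under which first-order terms
  cancel, and \<open>zero\<close> removes the first-order term of the quotient from its second-order
  derivative.\<close>

lemma pz_deriv2_quotient_le:
  fixes a b :: "'z::real_normed_vector \<Rightarrow> real"
  assumes cont: "isCont b x" and pos: "0 < b x"
    and a1: "clarke_deriv a x v = ereal (a x / b x * dir_deriv b x v)"
    and a2: "pz_deriv2 a x v \<le> ereal p"
    and b: "dir_deriv2_exists b x v"
    and zero: "clarke_deriv (\<lambda>x. a x / b x) x v = 0"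
  shows "pz_deriv2 (\<lambda>x. a x / b x) x v \<le> ereal ((p - a x / b x * dir_deriv2 b x v) / b x)"
proof -
  let ?z = "\<lambda>t. x + t *\<^sub>R v" and ?s = "a x / b x" and ?b = "dir_deriv b x v"
  have bz: "((\<lambda>t. b (?z t)) \<longlongrightarrow> b x) (at_right 0)"
    by (rule isCont_tendsto_compose[OF cont tendsto_along_direction])
  have "((\<lambda>t. - ?s * ((b (?z t) - b x - t * ?b) / (1/2 * t\<^sup>2)))
      \<longlongrightarrow> - ?s * dir_deriv2 b x v) (at_right 0)"
    by (intro tendsto_intros dir_deriv2_tendsto b)
  then have "limsup_le (at_right 0)
      (\<lambda>t. (a (?z t) - a x - t * (?s * ?b)) / (1/2 * t\<^sup>2)
        + - ?s * ((b (?z t) - b x - t * ?b) / (1/2 * t\<^sup>2))) (p + - ?s * dir_deriv2 b x v)"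
    using a2 unfolding pz_deriv2_le_iff[OF a1] by (intro limsup_le_add[OF _ limsup_le_tendsto])
  then have "limsup_le (at_right 0)
      (\<lambda>t. inverse (b (?z t)) * ((a (?z t) - a x - t * (?s * ?b)) / (1/2 * t\<^sup>2)
        + - ?s * ((b (?z t) - b x - t * ?b) / (1/2 * t\<^sup>2))))
      (inverse (b x) * (p + - ?s * dir_deriv2 b x v))"
    by (rule limsup_le_mult)
      (use order_tendstoD(1)[OF bz pos] bz pos in \<open>auto elim: eventually_mono intro: tendsto_inverse\<close>)
  moreover have "\<forall>\<^sub>F t in at_right 0. (a (?z t) / b (?z t) - a x / b x - t * 0) / (1/2 * t\<^sup>2)
      \<le> inverse (b (?z t)) * ((a (?z t) - a x - t * (?s * ?b)) / (1/2 * t\<^sup>2)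
        + - ?s * ((b (?z t) - b x - t * ?b) / (1/2 * t\<^sup>2)))"
    using order_tendstoD(1)[OF bz pos]
  proof eventually_elim
    case (elim t)
    then show ?case
      using quotient_difference_second_order[of "b x" "b (?z t)" "a (?z t)" "a x" "1/2 * t\<^sup>2" t ?b] pos
      by simp
  qed
  ultimately have "limsup_le (at_right 0)
      (\<lambda>t. (a (?z t) / b (?z t) - a x / b x - t * 0) / (1/2 * t\<^sup>2))
      (inverse (b x) * (p + - ?s * dir_deriv2 b x v))"
    by (rule limsup_le_mono)
  moreover have "inverse (b x) * (p + - ?s * dir_deriv2 b x v)
      = (p - a x / b x * dir_deriv2 b x v) / b x"
    by (simp add: field_simps)
  moreover have "clarke_deriv (\<lambda>x. a x / b x) x v = ereal 0"
    using zero by simp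
  ultimately show ?thesis
    by (subst pz_deriv2_le_iff) auto
qed

section \<open>Proper efficiency along feasible sequences\<close>

lemma borwein_properly_efficient_limsup:
  fixes \<phi> :: "'z \<Rightarrow> real^'p" and \<tau> :: "nat \<Rightarrow> real"
  assumes eff: "borwein_properly_efficient X \<phi> x0"
    and x: "\<And>n. x n \<in> X" and \<tau>: "\<And>n. 0 < \<tau> n" "\<tau> \<longlonglongrightarrow> 0"
    and lim: "\<And>i. limsup_le sequentially (\<lambda>n. (\<phi> (x n) $ i - \<phi> x0 $ i) / \<tau> n) (a i)"
    and le: "\<And>i. a i \<le> 0"
  shows "a i = 0"
proof -
  let ?q = "\<lambda>i n. (\<phi> (x n) $ i - \<phi> x0 $ i) / \<tau> n"
  \<comment> \<open>Raising each quotient to at least \<open>a i\<close> forces convergence to the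
    vector \<open>a\<close>; the excess over the true quotient is nonnegative and is absorbed by the
    orthant.\<close>
  define e :: "nat \<Rightarrow> real^'p" where "e n = (\<chi> i. max (?q i n) (a i))" for n
  have "e \<longlonglongrightarrow> (\<chi> i. a i)"
    unfolding e_def by (intro vec_tendstoI) (simp add: limsup_le_max[OF lim])
  moreover have "\<exists>u y. \<phi> x0 + \<tau> n *\<^sub>R e n = \<phi> u + y \<and> u \<in> X \<and> y \<in> nonneg_orthant" for n
  proof (intro exI conjI)
    show "\<phi> x0 + \<tau> n *\<^sub>R e n = \<phi> (x n) + (\<phi> x0 + \<tau> n *\<^sub>R e n - \<phi> (x n))" by simp
    have "\<phi> (x n) $ i - \<phi> x0 $ i = \<tau> n * ?q i n" for i
      using \<tau>(1)[of n] by simp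
    also have "\<tau> n * ?q i n \<le> \<tau> n * e n $ i" for i
      using \<tau>(1)[of n] by (intro mult_left_mono) (auto simp: e_def)
    finally have "\<phi> (x n) $ i - \<phi> x0 $ i \<le> \<tau> n * e n $ i" for i .
    then show "\<phi> x0 + \<tau> n *\<^sub>R e n - \<phi> (x n) \<in> nonneg_orthant"
      unfolding nonneg_orthant_def by (simp add: algebra_simps)
  qed (rule x)
  ultimately have "(\<chi> i. a i) \<in>
      contingent_cone {\<phi> x + y |x y. x \<in> X \<and> y \<in> nonneg_orthant} (\<phi> x0)"
    unfolding contingent_cone_def using \<tau> by blast
  moreover have "- (\<chi> i. a i) \<in> nonneg_orthant"
    using le by (simp add: nonneg_orthant_def)
  then have "(\<chi> i. a i) \<in> uminus ` nonneg_orthant"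
    by (metis image_eqI minus_minus)
  ultimately have "(\<chi> i. a i) = 0"
    using eff unfolding borwein_properly_efficient_def by blast
  then show ?thesis
    by (metis vec_lambda_beta zero_index)
qed

section \<open>Inconsistency of the second-order system\<close>

theorem theorem3p1:
  fixes U :: "'z::banach set"
    and f F :: "'z \<Rightarrow> real^'p"
    and m l :: nat
    and g h :: "nat \<Rightarrow> 'z \<Rightarrow> real"
    and F'G :: "'p \<Rightarrow> 'z \<Rightarrow> ('z \<Rightarrow>\<^sub>L real)"
    and x0 v :: 'z
    and s :: "'p \<Rightarrow> real"
  assumes reflexive: "reflexive_space TYPE('z)"
    and U: "open U" "U \<noteq> {}"
    and F_pos: "\<forall>x\<in>U. \<forall>i. 0 < F x $ i"
    and x0_U: "x0 \<in> U"
    and efficient: "borwein_properly_efficient (feasible_set U m g l h) (ratio f F) x0"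
    and s: "\<forall>i. s i = f x0 $ i / F x0 $ i"
    and lipschitz:
      "\<forall>i. locally_lipschitz_on U (\<lambda>x. f x $ i)"
      "\<forall>i. locally_lipschitz_on U (\<lambda>x. F x $ i)"
      "\<forall>j\<in>{1..m}. locally_lipschitz_on U (g j)"
      "\<forall>k\<in>{1..l}. locally_lipschitz_on U (h k)"
    and regular:
      "\<forall>i. \<forall>x\<in>U. clarke_regular (\<lambda>x. f x $ i) x"
      "\<forall>i. \<forall>x\<in>U. clarke_regular (\<lambda>x. F x $ i) x"
      "\<forall>j\<in>{1..m}. \<forall>x\<in>U. clarke_regular (g j) x"
      "\<forall>k\<in>{1..l}. \<forall>x\<in>U. clarke_regular (h k) x"
    and finite2:
      "\<forall>i. \<forall>x\<in>U. \<forall>d. \<bar>pz_deriv2 (\<lambda>x. f x $ i) x d\<bar> \<noteq> \<infinity>"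
      "\<forall>j\<in>{1..m}. \<forall>x\<in>U. \<forall>d. \<bar>pz_deriv2 (g j) x d\<bar> \<noteq> \<infinity>"
      "\<forall>k\<in>{1..l}. \<forall>x\<in>U. \<forall>d. \<bar>pz_deriv2 (h k) x d\<bar> \<noteq> \<infinity>"
    and F_gateaux: "\<forall>i. \<forall>x\<in>U. has_gateaux_derivative (\<lambda>x. F x $ i) (F'G i x) x"
    and F_deriv2: "\<forall>i. \<forall>x\<in>U. \<forall>d. dir_deriv2_exists (\<lambda>x. F x $ i) x d"
    and v: "v \<in> critical_points U f F m g l h x0"
    and abadie: "proj_linearizing_cone2 f F m g l h x0 v
                   \<subseteq> proj_tangent_cone2 (feasible_set U m g l h) x0 v"
  shows "\<forall>r\<ge>0. \<not> (\<exists>w.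
      (\<forall>i. clarke_deriv (\<lambda>x. f x $ i) x0 w + ereal r * pz_deriv2 (\<lambda>x. f x $ i) x0 v
             - ereal (s i * (blinfun_apply (F'G i x0) w + r * dir_deriv2 (\<lambda>x. F x $ i) x0 v)) \<le> 0) \<and>
      (\<exists>i. clarke_deriv (\<lambda>x. f x $ i) x0 w + ereal r * pz_deriv2 (\<lambda>x. f x $ i) x0 v
             - ereal (s i * (blinfun_apply (F'G i x0) w + r * dir_deriv2 (\<lambda>x. F x $ i) x0 v)) < 0) \<and>
      (\<forall>j\<in>active_set_dir m g x0 v.
           clarke_deriv (g j) x0 w + ereal r * pz_deriv2 (g j) x0 v \<le> 0) \<and>
      (\<forall>k\<in>{1..l}. clarke_deriv (h k) x0 w + ereal r * pz_deriv2 (h k) x0 v = 0))"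
proof (intro allI impI notI)
  fix r :: real
  assume r: "0 \<le> r"
  let ?f = "\<lambda>i x. f x $ i" and ?F = "\<lambda>i x. F x $ i"
    and ?\<phi> = "\<lambda>i x. f x $ i / F x $ i" and ?X = "feasible_set U m g l h"
  have ratio: "(\<lambda>x. ratio f F x $ i) = ?\<phi> i" for i
    by (simp add: ratio_def)
  have F0: "0 < F x0 $ i" for i
    using F_pos x0_U by auto
  have F_reg: "clarke_regular (?F i) x0" "has_gateaux_derivative (?F i) (F'G i x0) x0" for i
    using regular F_gateaux x0_U by auto
  have F_dir: "dir_deriv (?F i) x0 u = blinfun_apply (F'G i x0) u" "dir_deriv_exists (?F i) x0 u" for i u
    using F_reg(2)[of i] unfolding has_gateaux_derivative_def by auto
  have f_dir: "clarke_deriv (?f i) x0 u = ereal (dir_deriv (?f i) x0 u)" "dir_deriv_exists (?f i) x0 u" for i u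
    using regular(1) x0_U unfolding clarke_regular_def by metis+
  note F_cont = locally_lipschitz_on_imp_isCont[OF spec[OF lipschitz(2)] U(1) x0_U]
  \<comment> \<open>By \<open>upper\<close> and \<open>lower\<close> below, this real number is the
    Clarke derivative of \<open>?\<phi> i\<close> at \<open>x0\<close> in the direction
    \<open>u\<close>.\<close>
  define A where "A i u = (dir_deriv (?f i) x0 u - s i * blinfun_apply (F'G i x0) u) / F x0 $ i" for i u
  have upper: "clarke_deriv (?\<phi> i) x0 u \<le> ereal (A i u)" for i u
    using clarke_deriv_quotient_le[where a = "?f i" and b = "?F i", OF U(1) x0_U F0
        spec[OF lipschitz(1)] spec[OF lipschitz(2)] _ F_reg] f_dir s
    by (simp add: A_def)
  have lower: "ereal (A i u) \<le> clarke_deriv (?\<phi> i) x0 u" for i u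
    using clarke_deriv_quotient_ge[where a = "?f i" and b = "?F i", OF F_cont F0 f_dir(2) F_dir(2)]
      F_dir s by (simp add: A_def)
  have along: "limsup_le G (\<lambda>n. (?\<phi> i (y n + t n *\<^sub>R u n) - ?\<phi> i (y n)) / t n) (A i u0)"
    if "(y \<longlongrightarrow> x0) G" "filterlim t (at_right 0) G" "(u \<longlongrightarrow> u0) G"
    for i u0 G and y :: "nat \<Rightarrow> 'z" and t u
    using limsup_le_dir_quotient[where a = "?f i" and b = "?F i", OF U(1) x0_U F0
        spec[OF lipschitz(1)] spec[OF lipschitz(2)] _ F_reg that] f_dir s
    by (simp add: A_def)

  \<comment> \<open>A contingent direction comes with feasible points
    \<open>x0 + t n *\<^sub>R e n\<close>. The quotients of \<open>?\<phi> i\<close> along them have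
    upper limits at most \<open>A i v\<close>, which is nonpositive by criticality, so efficiency
    forces equality.\<close>
  have A_v: "A i v = 0" for i
  proof -
    obtain t :: "nat \<Rightarrow> real" and e where t: "\<And>n. 0 < t n" "t \<longlonglongrightarrow> 0" and e: "e \<longlonglongrightarrow> v"
      and X: "\<And>n. x0 + t n *\<^sub>R e n \<in> ?X"
      using v unfolding critical_points_def contingent_cone_def by blast
    have "filterlim t (at_right 0) sequentially"
      using t by (simp add: filterlim_at less_imp_neq[symmetric])
    from along[OF tendsto_const this e]
    have lim: "limsup_le sequentially
        (\<lambda>n. (ratio f F (x0 + t n *\<^sub>R e n) $ i - ratio f F x0 $ i) / t n) (A i v)" for i
      by (simp add: ratio_def)
    have "clarke_deriv (?\<phi> i) x0 v \<le> 0" for i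
      using v unfolding critical_points_def linearizing_cone_def ratio by simp
    then have "ereal (A i v) \<le> 0" for i
      using lower order_trans by blast
    then have "A i v \<le> 0" for i by simp
    from borwein_properly_efficient_limsup[OF efficient X t lim this] show ?thesis .
  qed
  have \<phi>_v: "clarke_deriv (?\<phi> i) x0 v = 0" for i
    using upper[of i v] lower[of i v] A_v[of i] by (simp add: zero_ereal_def)

  define P where "P i = real_of_ereal (pz_deriv2 (?f i) x0 v)" for i
  have P: "pz_deriv2 (?f i) x0 v = ereal (P i)" for i
    using finite2(1) x0_U by (simp add: P_def ereal_real)
  \<comment> \<open>Only an upper bound for the second-order derivative of \<open>?\<phi> i\<close>,
    which suffices because it is multiplied by the nonnegative \<open>r\<close>.\<close>
  define B where "B i = (P i - s i * dir_deriv2 (?F i) x0 v) / F x0 $ i" for i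
  have pz: "pz_deriv2 (?\<phi> i) x0 v \<le> ereal (B i)" for i
  proof -
    \<comment> \<open>\<open>A i v = 0\<close> is exactly the slope relation required by the
      second-order quotient rule.\<close>
    have "clarke_deriv (?f i) x0 v = ereal (?\<phi> i x0 * dir_deriv (?F i) x0 v)"
      using A_v[of i] F0[of i] s by (simp add: A_def f_dir F_dir)
    from pz_deriv2_quotient_le[where a = "?f i" and b = "?F i", OF F_cont F0 this _ _ \<phi>_v]
    show ?thesis
      using P F_deriv2 x0_U s by (simp add: B_def)
  qed

  assume "\<exists>w.
      (\<forall>i. clarke_deriv (?f i) x0 w + ereal r * pz_deriv2 (?f i) x0 v
             - ereal (s i * (blinfun_apply (F'G i x0) w + r * dir_deriv2 (?F i) x0 v)) \<le> 0) \<and>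
      (\<exists>i. clarke_deriv (?f i) x0 w + ereal r * pz_deriv2 (?f i) x0 v
             - ereal (s i * (blinfun_apply (F'G i x0) w + r * dir_deriv2 (?F i) x0 v)) < 0) \<and>
      (\<forall>j\<in>active_set_dir m g x0 v.
           clarke_deriv (g j) x0 w + ereal r * pz_deriv2 (g j) x0 v \<le> 0) \<and>
      (\<forall>k\<in>{1..l}. clarke_deriv (h k) x0 w + ereal r * pz_deriv2 (h k) x0 v = 0)"
  then obtain w i0 where
      le: "\<And>i. clarke_deriv (?f i) x0 w + ereal r * pz_deriv2 (?f i) x0 v
             - ereal (s i * (blinfun_apply (F'G i x0) w + r * dir_deriv2 (?F i) x0 v)) \<le> 0"
    and less: "clarke_deriv (?f i0) x0 w + ereal r * pz_deriv2 (?f i0) x0 v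
             - ereal (s i0 * (blinfun_apply (F'G i0 x0) w + r * dir_deriv2 (?F i0) x0 v)) < 0"
    and gh: "\<forall>j\<in>active_set_dir m g x0 v.
           clarke_deriv (g j) x0 w + ereal r * pz_deriv2 (g j) x0 v \<le> 0"
      "\<forall>k\<in>{1..l}. clarke_deriv (h k) x0 w + ereal r * pz_deriv2 (h k) x0 v = 0"
    by blast
  \<comment> \<open>The left-hand side of the system divided by the positive
    \<open>F x0 $ i\<close>, so signs carry over.\<close>
  have AB: "A i w + r * B i = (dir_deriv (?f i) x0 w + r * P i
      - s i * (blinfun_apply (F'G i x0) w + r * dir_deriv2 (?F i) x0 v)) / F x0 $ i" for i
    using F0[of i] by (simp add: A_def B_def field_simps)
  have AB_le: "A i w + r * B i \<le> 0" for i
    unfolding AB using le[of i] F0[of i] by (simp add: f_dir P divide_le_0_iff zero_ereal_def)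
  have AB_less: "A i0 w + r * B i0 < 0"
    unfolding AB using less F0[of i0] by (simp add: f_dir P divide_less_0_iff zero_ereal_def)

  have "clarke_deriv (?\<phi> i) x0 w + ereal r * pz_deriv2 (?\<phi> i) x0 v \<le> 0" for i
  proof -
    have "clarke_deriv (?\<phi> i) x0 w + ereal r * pz_deriv2 (?\<phi> i) x0 v \<le> ereal (A i w) + ereal r * ereal (B i)"
      using r by (intro add_mono upper ereal_mult_left_mono pz) simp
    also have "\<dots> \<le> 0" using AB_le[of i] by (simp add: zero_ereal_def)
    finally show ?thesis .
  qed
  then have "(w, r) \<in> proj_linearizing_cone2 f F m g l h x0 v"
    using r gh unfolding proj_linearizing_cone2_def ratio by blast
  then have "(w, r) \<in> proj_tangent_cone2 ?X x0 v"
    using abadie by blast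
  then obtain t \<rho> :: "nat \<Rightarrow> real" and \<omega> :: "nat \<Rightarrow> 'z"
    where t: "\<And>n. 0 < t n" "t \<longlonglongrightarrow> 0" and \<rho>: "\<And>n. 0 < \<rho> n" "\<rho> \<longlonglongrightarrow> r" and \<omega>: "\<omega> \<longlonglongrightarrow> w"
      and t\<rho>: "(\<lambda>n. t n / \<rho> n) \<longlonglongrightarrow> 0"
      and X: "\<And>n. x0 + t n *\<^sub>R v + (1/2 * inverse (\<rho> n) * (t n)\<^sup>2) *\<^sub>R \<omega> n \<in> ?X"
    unfolding proj_tangent_cone2_def by blast
  \<comment> \<open>The step length of the correction \<open>\<omega> n\<close>; it replaces
    \<open>1/2 * (t n)\<^sup>2\<close> as the scale of the difference quotients.\<close>
  define \<tau> where "\<tau> n = 1/2 * inverse (\<rho> n) * (t n)\<^sup>2" for n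
  let ?y = "\<lambda>n. x0 + t n *\<^sub>R v"
  have \<tau>_pos: "0 < \<tau> n" for n
    using t(1)[of n] \<rho>(1)[of n] by (simp add: \<tau>_def)
  \<comment> \<open>Writing \<open>\<tau> n\<close> with the factor \<open>t n / \<rho> n\<close>
    covers the case \<open>r = 0\<close>, where \<open>inverse (\<rho> n)\<close> is
    unbounded.\<close>
  have "(\<lambda>n. 1/2 * t n * (t n / \<rho> n)) \<longlonglongrightarrow> 1/2 * 0 * 0"
    by (intro tendsto_intros t t\<rho>)
  then have \<tau>_0: "\<tau> \<longlonglongrightarrow> 0"
    unfolding \<tau>_def by (simp add: field_simps power2_eq_square)
  have \<tau>_right: "filterlim \<tau> (at_right 0) sequentially"
    using \<tau>_pos \<tau>_0 by (simp add: filterlim_at less_imp_neq[symmetric])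
  have t_right: "filterlim t (at_right 0) sequentially"
    using t by (simp add: filterlim_at less_imp_neq[symmetric])
  have y: "?y \<longlonglongrightarrow> x0"
    by (rule filterlim_compose[OF tendsto_along_direction t_right])
  have "limsup_le (at_right 0) (\<lambda>t. (?\<phi> i (x0 + t *\<^sub>R v) - ?\<phi> i x0 - t * 0) / (1/2 * t\<^sup>2)) (B i)" for i
    using pz[of i] pz_deriv2_le_iff[of "?\<phi> i" x0 v 0] \<phi>_v[of i] by (simp add: zero_ereal_def)
  then have "limsup_le sequentially (\<lambda>n. \<rho> n * ((?\<phi> i (?y n) - ?\<phi> i x0 - t n * 0) / (1/2 * (t n)\<^sup>2)))
      (r * B i)" for i
    by (rule limsup_le_mult[OF limsup_le_compose[OF _ t_right]])
      (simp_all add: \<rho> less_imp_le)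
  note lims = limsup_le_add[OF along[OF y \<tau>_right \<omega>] this]
  \<comment> \<open>The increment is split at \<open>?y n\<close>: the move from \<open>x0\<close>
    along \<open>v\<close> is of second order and, measured at scale \<open>\<tau> n\<close>, gains
    the factor \<open>\<rho> n\<close>; the move along \<open>\<omega> n\<close> is of first order
    with moving base point \<open>?y n\<close>, as \<open>along\<close> permits.\<close>
  have "(ratio f F (?y n + \<tau> n *\<^sub>R \<omega> n) $ i - ratio f F x0 $ i) / \<tau> n
      = (?\<phi> i (?y n + \<tau> n *\<^sub>R \<omega> n) - ?\<phi> i (?y n)) / \<tau> n
        + \<rho> n * ((?\<phi> i (?y n) - ?\<phi> i x0 - t n * 0) / (1/2 * (t n)\<^sup>2))" for n i
  proof -
    have "\<rho> n * ((?\<phi> i (?y n) - ?\<phi> i x0 - t n * 0) / (1/2 * (t n)\<^sup>2))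
        = (?\<phi> i (?y n) - ?\<phi> i x0) / \<tau> n"
      using t(1)[of n] \<rho>(1)[of n] by (simp add: \<tau>_def divide_simps)
    then show ?thesis
      by (simp add: ratio_def diff_divide_distrib)
  qed
  with lims have "limsup_le sequentially
      (\<lambda>n. (ratio f F (?y n + \<tau> n *\<^sub>R \<omega> n) $ i - ratio f F x0 $ i) / \<tau> n) (A i w + r * B i)" for i
    by simp
  from borwein_properly_efficient_limsup[OF efficient X[folded \<tau>_def] \<tau>_pos \<tau>_0 this AB_le]
  have "A i0 w + r * B i0 = 0" .
  with AB_less show False by simp
qed

end
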